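(* Every Scott-closed irreducible subset of $\mathcal{H}$ is either of the form ${\downarrow}x$ for some $x\in\mathcal{H}$, or of the form ${\downarrow}L_s$ for some $s\in\mathbb{N}^*$, where $L_s=\{(m,s)\mid m\in\mathbb{N}\}$.
   Context: Let $\mathbb{N}^*$ be the set of finite strings of natural numbers; $\varepsilon$ is the empty string, $n{:}s$ is $s$ with $n$ put in front, $ts$ is concatenation, and for nonempty $t$, $\min(t)$ is its least entry. On $\mathbb{N}\times\mathbb{N}^*$ define, for $m,m',n,n'\in\mathbb{N}$, $s,t\in\mathbb{N}^*$: $(m,n{:}s)<_1(m,n'{:}s)$ if $n<n'$; $(m,ts)<_2(m,s)$ if $t\neq\varepsilon$; $(m,ts)<_3(m',s)$ if $t\ne\varepsilon$ and $\min(t)\le m'$. Let $<\;=\;<_1\cup<_2\cup<_3\cup(<_2;<_1)\cup(<_3;<_1)$ ($x\,(R;R')\,z$ iff $\exists y$, $x\,R\,y$, $y\,R'\,z$) and $\le\;=\;<\cup=$; $\mathcal{H}=(\mathbb{N}\times\mathbb{N}^*,\le)$, a dcpo. Irreducible means (with respect to the Scott topology) nonempty and, whenever contained in a union of two Scott-closed sets, contained in one of them. *)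

theory Defs
  imports "HOL-Analysis.Abstract_Topology" "HOL-Library.Lub_Glb"
begin

section \<open>The Scott topology of a partial order\<close>

definition directed :: "'a::order set \<Rightarrow> bool" where
  "directed D \<longleftrightarrow> D \<noteq> {} \<and> (\<forall>x\<in>D. \<forall>y\<in>D. \<exists>z\<in>D. x \<le> z \<and> y \<le> z)"

definition upper_set :: "'a::order set \<Rightarrow> bool" where
  "upper_set U \<longleftrightarrow> (\<forall>x\<in>U. \<forall>y. x \<le> y \<longrightarrow> y \<in> U)"

definition lower_set :: "'a::order set \<Rightarrow> bool" where
  "lower_set A \<longleftrightarrow> (\<forall>x\<in>A. \<forall>y. y \<le> x \<longrightarrow> y \<in> A)"

definition down_closure :: "'a::order set \<Rightarrow> 'a set" where
  "down_closure A = {y. \<exists>x\<in>A. y \<le> x}"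

definition scott_open :: "'a::order set \<Rightarrow> bool" where
  "scott_open U \<longleftrightarrow>
     upper_set U \<and> (\<forall>D x. directed D \<longrightarrow> isLub UNIV D x \<longrightarrow> x \<in> U \<longrightarrow> D \<inter> U \<noteq> {})"

definition scott_topology :: "'a::order topology" where
  "scott_topology = topology scott_open"

lemma istopology_scott_open: "istopology (scott_open :: 'a::order set \<Rightarrow> bool)"
  unfolding istopology_def
proof (intro conjI allI impI)
  fix S T :: "'a set"
  assume S: "scott_open S" and T: "scott_open T"
  show "scott_open (S \<inter> T)"
    unfolding scott_open_def
  proof (intro conjI allI impI)
    show "upper_set (S \<inter> T)"
      using S T unfolding scott_open_def upper_set_def by blast
  next
    fix D :: "'a set" and x
    assume D: "directed D" and x: "isLub UNIV D x" "x \<in> S \<inter> T"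
    obtain a where a: "a \<in> D" "a \<in> S" using S D x unfolding scott_open_def by blast
    obtain b where b: "b \<in> D" "b \<in> T" using T D x unfolding scott_open_def by blast
    obtain c where c: "c \<in> D" "a \<le> c" "b \<le> c" using D a b unfolding directed_def by blast
    have "c \<in> S" "c \<in> T"
      using S T a b c unfolding scott_open_def upper_set_def by blast+
    then show "D \<inter> (S \<inter> T) \<noteq> {}" using c by blast
  qed
next
  fix K :: "'a set set"
  assume K: "Ball K scott_open"
  show "scott_open (\<Union>K)"
    unfolding scott_open_def
  proof (intro conjI allI impI)
    show "upper_set (\<Union>K)"
      using K unfolding scott_open_def upper_set_def by blast
  next
    fix D :: "'a set" and x
    assume D: "directed D" and x: "isLub UNIV D x" "x \<in> \<Union>K"
    then obtain U where U: "U \<in> K" "x \<in> U" by blast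
    then have "D \<inter> U \<noteq> {}" using K D x unfolding scott_open_def by blast
    then show "D \<inter> \<Union>K \<noteq> {}" using U by blast
  qed
qed

lemma openin_scott_topology: "openin scott_topology U \<longleftrightarrow> scott_open U"
  by (simp add: scott_topology_def istopology_scott_open)

lemma topspace_scott_topology [simp]: "topspace scott_topology = UNIV"
proof -
  have "scott_open (UNIV :: 'a set)"
    by (auto simp: scott_open_def upper_set_def directed_def)
  then show ?thesis
    by (metis openin_scott_topology openin_subset top.extremum_uniqueI)
qed

lemma closedin_scott_topology:
  "closedin scott_topology A \<longleftrightarrow>
     lower_set A \<and> (\<forall>D x. directed D \<longrightarrow> D \<subseteq> A \<longrightarrow> isLub UNIV D x \<longrightarrow> x \<in> A)"
proof -
  have "upper_set (- A) \<longleftrightarrow> lower_set A"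
    unfolding upper_set_def lower_set_def by blast
  then show ?thesis
    by (auto simp: closedin_def openin_scott_topology scott_open_def Compl_eq_Diff_UNIV [symmetric])
qed

definition irreducible_in :: "'a topology \<Rightarrow> 'a set \<Rightarrow> bool" where
  "irreducible_in X S \<longleftrightarrow> S \<subseteq> topspace X \<and> S \<noteq> {} \<and>
     (\<forall>A B. closedin X A \<longrightarrow> closedin X B \<longrightarrow> S \<subseteq> A \<union> B \<longrightarrow> S \<subseteq> A \<or> S \<subseteq> B)"


section \<open>The poset on pairs of a number and a string\<close>

text \<open>
  A copy of \<open>nat \<times> nat list\<close>, kept as a separate type so that it can carry its own order
  instead of an instance for product types.
\<close>

datatype H = H nat "nat list"

definition lt1 :: "H rel" where
  "lt1 = {(H m (n # s), H m (n' # s)) | m n n' s. n < n'}"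

definition lt2 :: "H rel" where
  "lt2 = {(H m (t @ s), H m s) | m t s. t \<noteq> []}"

definition lt3 :: "H rel" where
  "lt3 = {(H m (t @ s), H m' s) | m m' t s. t \<noteq> [] \<and> Min (set t) \<le> m'}"

text \<open>\<^const>\<open>relcomp\<close> composes from left to right, as in \<open>x (R; R') z\<close>.\<close>

definition ltH :: "H rel" where
  "ltH = lt1 \<union> lt2 \<union> lt3 \<union> (lt2 O lt1) \<union> (lt3 O lt1)"

lemma lt1_lt1: "lt1 O lt1 \<subseteq> lt1"
  unfolding lt1_def by auto

lemma lt1_lt2: "lt1 O lt2 \<subseteq> lt2"
proof
  fix p assume "p \<in> lt1 O lt2"
  then obtain m n n' s t s' where p: "p = (H m (n # s), H m s')"
    and eq: "t @ s' = n' # s" "t \<noteq> []"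
    unfolding lt1_def lt2_def by auto
  from eq obtain u where "s = u @ s'" by (cases t) auto
  with p have "p = (H m ((n # u) @ s'), H m s')" by simp
  then show "p \<in> lt2" unfolding lt2_def by blast
qed

lemma lt1_lt3: "lt1 O lt3 \<subseteq> lt3"
proof
  fix p assume "p \<in> lt1 O lt3"
  then obtain m m' n n' s t s' where p: "p = (H m (n # s), H m' s')"
    and n: "n < n'" and eq: "n' # s = t @ s'" "t \<noteq> []" and t: "Min (set t) \<le> m'"
    unfolding lt1_def lt3_def by auto
  from eq obtain u where u: "t = n' # u" "s = u @ s'" by (cases t) auto
  have "Min (set (n # u)) \<le> m'"
    using n t u by (cases "u = []") (auto simp: min_le_iff_disj)
  moreover have "p = (H m ((n # u) @ s'), H m' s')" using p u by simp
  ultimately show "p \<in> lt3" unfolding lt3_def by blast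
qed

lemma lt2_lt2: "lt2 O lt2 \<subseteq> lt2"
proof
  fix p assume "p \<in> lt2 O lt2"
  then obtain m t u s where "p = (H m (t @ u @ s), H m s)" "t \<noteq> []"
    unfolding lt2_def by auto
  then have "p = (H m ((t @ u) @ s), H m s) \<and> t @ u \<noteq> []" by simp
  then show "p \<in> lt2" unfolding lt2_def by blast
qed

lemma Min_append_le:
  fixes t u :: "nat list"
  assumes "t \<noteq> [] \<and> Min (set t) \<le> m \<or> u \<noteq> [] \<and> Min (set u) \<le> m"
  shows "Min (set (t @ u)) \<le> m"
  using assms by (cases "t = []"; cases "u = []") (auto simp: Min_Un)

lemma lt3I: "t \<noteq> [] \<and> Min (set t) \<le> m' \<or> u \<noteq> [] \<and> Min (set u) \<le> m'
  \<Longrightarrow> (H m (t @ u @ s), H m' s) \<in> lt3"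
  using Min_append_le [of t m' u] unfolding lt3_def
  by (intro CollectI exI [of _ m] exI [of _ m'] exI [of _ "t @ u"] exI [of _ s]) auto

lemma lt2_lt3: "lt2 O lt3 \<subseteq> lt3"
proof
  fix p assume "p \<in> lt2 O lt3"
  then obtain m m' t u s where "p = (H m (t @ u @ s), H m' s)"
    "t \<noteq> [] \<and> Min (set t) \<le> m' \<or> u \<noteq> [] \<and> Min (set u) \<le> m'"
    unfolding lt2_def lt3_def by auto
  then show "p \<in> lt3" using lt3I by blast
qed

lemma lt3_lt2: "lt3 O lt2 \<subseteq> lt3"
proof
  fix p assume "p \<in> lt3 O lt2"
  then obtain m m' t u s where "p = (H m (t @ u @ s), H m' s)"
    "t \<noteq> [] \<and> Min (set t) \<le> m' \<or> u \<noteq> [] \<and> Min (set u) \<le> m'"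
    unfolding lt2_def lt3_def by auto
  then show "p \<in> lt3" using lt3I by blast
qed

lemma lt3_lt3: "lt3 O lt3 \<subseteq> lt3"
proof
  fix p assume "p \<in> lt3 O lt3"
  then obtain m m' t u s where "p = (H m (t @ u @ s), H m' s)"
    "t \<noteq> [] \<and> Min (set t) \<le> m' \<or> u \<noteq> [] \<and> Min (set u) \<le> m'"
    unfolding lt2_def lt3_def by auto
  then show "p \<in> lt3" using lt3I by blast
qed

lemma ltH_trans: "(x, y) \<in> ltH \<Longrightarrow> (y, z) \<in> ltH \<Longrightarrow> (x, z) \<in> ltH"
proof -
  define b where "b = lt2 \<union> lt3"
  have bb: "b O b \<subseteq> b" and ab: "lt1 O b \<subseteq> b"
    unfolding b_def using lt2_lt2 lt2_lt3 lt3_lt2 lt3_lt3 lt1_lt2 lt1_lt3 by blast+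
  have ltH: "ltH = lt1 \<union> b \<union> b O lt1" unfolding ltH_def b_def by blast
  have "ltH O ltH \<subseteq> ltH" unfolding ltH using bb ab lt1_lt1 by blast
  then show "(x, y) \<in> ltH \<Longrightarrow> (y, z) \<in> ltH \<Longrightarrow> (x, z) \<in> ltH" by blast
qed

lemma ltH_irrefl: "(x, x) \<notin> ltH"
  unfolding ltH_def lt1_def lt2_def lt3_def by (auto dest!: arg_cong [where f = length])

instantiation H :: order
begin

definition less_H :: "H \<Rightarrow> H \<Rightarrow> bool" where
  "x < y \<longleftrightarrow> (x, y) \<in> ltH"

definition less_eq_H :: "H \<Rightarrow> H \<Rightarrow> bool" where
  "x \<le> y \<longleftrightarrow> x < y \<or> x = (y :: H)"

instance
  by standard (auto simp: less_H_def less_eq_H_def ltH_irrefl dest: ltH_trans)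

end

definition Lset :: "nat list \<Rightarrow> H set" where
  "Lset s = {H m s | m. True}"

end

theory Submission
  imports Defs
begin

text \<open>
  A lower set is Scott closed iff it contains \<open>(m, s)\<close> whenever it contains all \<open>(m, n:s)\<close>.
  For a closed set \<open>C\<close>, let \<open>A\<close> be the union of all \<open>L\<^sub>s \<subseteq> C\<close>; every element of \<open>C\<close> is below a
  maximal one. If some maximal \<open>x\<close> is outside \<open>A\<close>, then \<open>C\<close> is covered by the closed sets
  \<open>\<down>x\<close> and \<open>A \<union> \<down>(C - \<down>x)\<close>, and the second one misses \<open>x\<close>, so \<open>C = \<down>x\<close>. Otherwise \<open>C = A\<close>,
  and a maximal element \<open>(m, s)\<close> of \<open>C\<close> yields the cover by \<open>\<down>L\<^sub>s\<close> and \<open>\<down>(C - \<down>L\<^sub>s)\<close>,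
  so \<open>C = \<down>L\<^sub>s\<close>.
\<close>

section \<open>The order\<close>

text \<open>The reflexive closure of \<open>lt1\<close> seen on strings only, as \<open>lt1\<close>
  fixes the number. Reflexivity lets one formula cover comparisons with and without a final
  \<open>lt1\<close> step.\<close>

definition bump :: "nat list \<Rightarrow> nat list \<Rightarrow> bool" where
  "bump u v \<longleftrightarrow> u = v \<or> (\<exists>n n' w. u = n # w \<and> v = n' # w \<and> n < n')"

lemma Min_set_le_iff:
  "t \<noteq> [] \<Longrightarrow> Min (set t) \<le> m \<longleftrightarrow> (\<exists>a\<in>set t. a \<le> m)"
  by (simp add: Min_le_iff)

text \<open>Merges all cases of the order: drop a prefix \<open>t\<close>, then possibly raise the
  head. The number may change only if some dropped entry is at most the new one; with
  \<open>t = []\<close> there is none, which forces \<open>m = m'\<close>.\<close>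

lemma H_le_iff:
  "H m s \<le> H m' s' \<longleftrightarrow> (\<exists>t u. s = t @ u \<and> bump u s' \<and> (m = m' \<or> (\<exists>a\<in>set t. a \<le> m')))"
  (is "?L \<longleftrightarrow> ?R")
proof
  have lt1: "\<exists>n n' w. s = n # w \<and> s' = n' # w \<and> n < n' \<and> m = m'"
    if "(H m s, H m' s') \<in> lt1" for m s m' s'
    using that unfolding lt1_def by auto
  have lt2: "\<exists>t. s = t @ s' \<and> t \<noteq> [] \<and> m = m'" if "(H m s, H m' s') \<in> lt2" for m s m' s'
    using that unfolding lt2_def by auto
  have lt3: "\<exists>t. s = t @ s' \<and> t \<noteq> [] \<and> (\<exists>a\<in>set t. a \<le> m')"
    if "(H m s, H m' s') \<in> lt3" for m s m' s'
    using that unfolding lt3_def by (auto simp: Min_set_le_iff)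
  assume ?L
  then consider "m = m'" "s = s'" | "(H m s, H m' s') \<in> lt1" | "(H m s, H m' s') \<in> lt2 \<union> lt3"
    | k v where "(H m s, H k v) \<in> lt2 \<union> lt3" "(H k v, H m' s') \<in> lt1"
    unfolding less_eq_H_def less_H_def ltH_def by (auto, metis H.exhaust, metis H.exhaust)
  then show ?R
  proof cases
    case 1
    then show ?thesis by (auto simp: bump_def)
  next
    case 2
    then show ?thesis using lt1 [OF 2] by (fastforce simp: bump_def)
  next
    case 3
    then obtain t where "s = t @ s'" "m = m' \<or> (\<exists>a\<in>set t. a \<le> m')" using lt2 lt3 by blast
    then show ?thesis by (auto simp: bump_def)
  next
    case 4
    then obtain t where "s = t @ v" "m = k \<or> (\<exists>a\<in>set t. a \<le> k)" using lt2 lt3 by blast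
    moreover have "bump v s'" "k = m'" using lt1 [OF 4(2)] by (auto simp: bump_def)
    ultimately show ?thesis by blast
  qed
next
  assume ?R
  then obtain t u where tu: "s = t @ u" "bump u s'" "m = m' \<or> (\<exists>a\<in>set t. a \<le> m')" by blast
  have 1: "H m s \<le> H m' u"
  proof (cases "t = []")
    case True
    then show ?thesis using tu by (simp add: less_eq_H_def)
  next
    case False
    then have "(H m s, H m' u) \<in> lt2 \<union> lt3"
      using tu by (auto simp: lt2_def lt3_def Min_set_le_iff)
    then show ?thesis by (auto simp: less_eq_H_def less_H_def ltH_def)
  qed
  have "H m' u \<le> H m' s'"
    using tu(2) by (auto simp: bump_def less_eq_H_def less_H_def ltH_def lt1_def)
  with 1 show ?L by (rule order_trans)
qed

text \<open>With equal numbers, \<open>H_le_iff\<close> accepts any dropped prefix, so only the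
  strings matter.\<close>

lemma H_le_change_fst: "H m s \<le> H m' s' \<Longrightarrow> H k s \<le> H k s'"
  unfolding H_le_iff by blast

lemma H_head_mono: "n \<le> n' \<Longrightarrow> H m (n # s) \<le> H m (n' # s)"
  unfolding H_le_iff bump_def by (cases "n = n'") fastforce+

lemma H_Cons_le_tail: "H m (n # s) \<le> H m s"
  unfolding H_le_iff bump_def by (intro exI [of _ "[n]"] exI [of _ s]) simp

lemma H_Cons_le_change_fst: "n \<le> m' \<Longrightarrow> H m (n # s) \<le> H m' s"
  unfolding H_le_iff bump_def by (intro exI [of _ "[n]"] exI [of _ s]) simp

text \<open>Splits on the dropped prefix. If it is empty, only the head rises (second case). If it
  starts with \<open>n\<close>, either the number stays or a later entry justifies its change (first
  case), or \<open>n\<close> itself does (third case).\<close>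

lemma H_Cons_leE:
  assumes "H m (n # s) \<le> H m' s'"
  obtains "H m s \<le> H m' s'"
    | n' where "m' = m" "n \<le> n'" "s' = n' # s"
    | "n \<le> m'" "H m s \<le> H m s'"
proof -
  obtain t u where tu: "n # s = t @ u" "bump u s'" "m = m' \<or> (\<exists>a\<in>set t. a \<le> m')"
    using assms unfolding H_le_iff by blast
  show ?thesis
  proof (cases t)
    case Nil
    with tu have "\<exists>n'\<ge>n. s' = n' # s" "m = m'" by (auto simp: bump_def)
    then show ?thesis using that(2) by blast
  next
    case (Cons a t')
    with tu have "s = t' @ u" "a = n" by auto
    then show ?thesis using tu Cons that(1,3) unfolding H_le_iff by auto
  qed
qed

primrec string_length :: "H \<Rightarrow> nat" where
  "string_length (H m s) = length s"

text \<open>Since \<open>bump\<close> preserves length, the dropped prefix must be empty.\<close>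

lemma le_of_string_length_le:
  assumes "x \<le> z" "string_length x \<le> string_length z"
  shows "z = x \<or> (\<exists>m n n' s. x = H m (n # s) \<and> z = H m (n' # s) \<and> n < n')"
proof -
  obtain m s m' s' where x: "x = H m s" "z = H m' s'" by (metis H.exhaust)
  obtain t u where tu: "s = t @ u" "bump u s'" "m = m' \<or> (\<exists>a\<in>set t. a \<le> m')"
    using assms unfolding x H_le_iff by blast
  then have "t = []" using assms by (auto simp: x bump_def)
  then show ?thesis using tu by (auto simp: x bump_def)
qed

section \<open>Scott-closed sets\<close>

lemma H_tail_le:
  assumes "\<And>n. H m (n # s) \<le> y"
  shows "H m s \<le> y"
proof -
  obtain m' s' where y: "y = H m' s'" by (metis H.exhaust)
  \<comment> \<open>Exceeds \<open>m'\<close> and the head of \<open>s'\<close>, if there is one,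
    which refutes the last two cases of \<open>H_Cons_leE\<close>.\<close>
  define n where "n = Suc (m' + (case s' of [] \<Rightarrow> 0 | a # _ \<Rightarrow> a))"
  show ?thesis
    using assms [of n] unfolding y by (cases rule: H_Cons_leE) (auto simp: n_def)
qed

lemma isLub_H_tail: "isLub UNIV (range (\<lambda>n. H m (n # s))) (H m s)"
proof (rule isLubI2)
  show "isUb UNIV (range (\<lambda>n. H m (n # s))) (H m s)"
    by (auto simp: isUb_def setle_def H_Cons_le_tail)
  show "H m s <=* Collect (isUb UNIV (range (\<lambda>n. H m (n # s))))"
    by (auto simp: setge_def isUb_def setle_def intro: H_tail_le)
qed

lemma lower_setD: "lower_set A \<Longrightarrow> x \<in> A \<Longrightarrow> y \<le> x \<Longrightarrow> y \<in> A"
  unfolding lower_set_def by blast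

lemma lower_set_headD:
  "lower_set A \<Longrightarrow> H m (n' # s) \<in> A \<Longrightarrow> n \<le> n' \<Longrightarrow> H m (n # s) \<in> A"
  by (rule lower_setD [OF _ _ H_head_mono])

text \<open>For the converse, take \<open>d\<close> of shortest string in a directed set
  \<open>D\<close>. Above \<open>d\<close>, the set can only vary the head, so it has a greatest
  element or is cofinal in a chain \<open>H m (n # s)\<close> with supremum
  \<open>H m s\<close>.\<close>

lemma closedin_scott_H_iff:
  "closedin scott_topology A \<longleftrightarrow>
     lower_set A \<and> (\<forall>m s. (\<forall>n. H m (n # s) \<in> A) \<longrightarrow> H m s \<in> A)"
proof (intro iffI conjI allI impI)
  assume A: "closedin scott_topology A"
  then show "lower_set A" by (simp add: closedin_scott_topology)
  fix m s
  assume "\<forall>n. H m (n # s) \<in> A"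
  moreover have "directed (range (\<lambda>n. H m (n # s)))"
    unfolding directed_def
    by (auto, metis H_head_mono max.cobounded1 max.cobounded2)
  ultimately show "H m s \<in> A"
    using A isLub_H_tail [of m s] unfolding closedin_scott_topology by blast
next
  assume "lower_set A \<and> (\<forall>m s. (\<forall>n. H m (n # s) \<in> A) \<longrightarrow> H m s \<in> A)"
  then have low: "lower_set A" and lim: "\<And>m s. (\<And>n. H m (n # s) \<in> A) \<Longrightarrow> H m s \<in> A" by blast+
  show "closedin scott_topology A"
    unfolding closedin_scott_topology
  proof (intro conjI allI impI low)
    fix D x
    assume D: "directed D" "D \<subseteq> A" and x: "isLub UNIV D x"
    \<comment> \<open>An upper bound of \<open>D\<close> inside \<open>A\<close> suffices, since the
      supremum lies below it.\<close>
    have least: "x \<in> A" if "y \<in> A" "\<And>e. e \<in> D \<Longrightarrow> e \<le> y" for y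
    proof -
      have "x \<le> y" using isLub_le_isUb [OF x, of y] that by (auto simp: isUb_def setle_def)
      then show ?thesis using low that(1) by (blast intro: lower_setD)
    qed
    obtain d where d: "d \<in> D" "\<And>e. e \<in> D \<Longrightarrow> string_length d \<le> string_length e"
      using D(1) ex_has_least_nat [of "\<lambda>x. x \<in> D" _ string_length] unfolding directed_def by blast
    \<comment> \<open>Directedness gives \<open>z\<close> above both \<open>e\<close> and
      \<open>d\<close>; as \<open>d\<close> is shortest, \<open>z\<close> differs from it at most by
      a larger head.\<close>
    have ub: "\<exists>z\<in>D. e \<le> z \<and> (z = d \<or> (\<exists>m n n' s. d = H m (n # s) \<and> z = H m (n' # s) \<and> n < n'))"
      if "e \<in> D" for e
      using D(1) d that le_of_string_length_le unfolding directed_def by metis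
    obtain m v where dmv: "d = H m v" by (metis H.exhaust)
    show "x \<in> A"
    proof (cases v)
      case Nil
      have "e \<le> d" if "e \<in> D" for e
        using ub [OF that] by (auto simp: dmv Nil)
      then show ?thesis using least d(1) D(2) by blast
    next
      case (Cons n s)
      define N where "N = {n'. H m (n' # s) \<in> D}"
      have ubN: "\<exists>n'\<in>N. e \<le> H m (n' # s)" if "e \<in> D" for e
        using ub [OF that] d(1) by (auto simp: N_def dmv Cons)
      show ?thesis
      proof (cases "finite N")
        case True
        have "N \<noteq> {}" using ubN d(1) by blast
        then have "Max N \<in> N" using True by simp
        then have "H m (Max N # s) \<in> A" using D(2) by (auto simp: N_def)
        moreover have "e \<le> H m (Max N # s)" if "e \<in> D" for e
          using ubN [OF that] True by (meson H_head_mono Max_ge order_trans)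
        ultimately show ?thesis using least by blast
      next
        case False
        have "H m (k # s) \<in> A" for k
        proof -
          obtain n' where "n' \<ge> k" "n' \<in> N" using False by (meson infinite_nat_iff_unbounded_le)
          moreover from this have "H m (n' # s) \<in> A" using D(2) by (auto simp: N_def)
          ultimately show ?thesis using low lower_set_headD by blast
        qed
        then have "H m s \<in> A" by (rule lim)
        moreover have "e \<le> H m s" if "e \<in> D" for e
          using ubN [OF that] H_Cons_le_tail order_trans by blast
        ultimately show ?thesis using least by blast
      qed
    qed
  qed
qed

section \<open>Closed sets generated by points and by the sets \<open>Lset s\<close>; maximal
  elements\<close>

lemma lower_set_down_closure: "lower_set (down_closure A)"
  unfolding lower_set_def down_closure_def using order_trans by blast

lemma down_closure_subset: "lower_set C \<Longrightarrow> A \<subseteq> C \<Longrightarrow> down_closure A \<subseteq> C"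
  unfolding lower_set_def down_closure_def by blast

lemma subset_down_closure: "A \<subseteq> down_closure A"
  unfolding down_closure_def by blast

lemma closedin_down_closure_singleton: "closedin scott_topology (down_closure {x :: H})"
  unfolding closedin_scott_H_iff using lower_set_down_closure [of "{x}"]
  by (auto simp: down_closure_def intro: H_tail_le)

text \<open>By \<open>H_le_change_fst\<close>, the bound in \<open>Lset v\<close> can be taken with
  the same number \<open>m\<close>.\<close>

lemma mem_down_closure_Lset: "H m s \<in> down_closure (Lset v) \<longleftrightarrow> H m s \<le> H m v"
  unfolding down_closure_def Lset_def using H_le_change_fst by blast

lemma closedin_down_closure_Lset: "closedin scott_topology (down_closure (Lset s))"
  unfolding closedin_scott_H_iff mem_down_closure_Lset
  using lower_set_down_closure by (blast intro: H_tail_le)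

text \<open>Given \<open>n\<close>, some \<open>H k s\<close> in \<open>C\<close> has
  \<open>k \<ge> n\<close>, and every \<open>H m (n # s)\<close> lies below it by
  \<open>lt3\<close>. The limits \<open>H m s\<close> follow.\<close>

lemma closed_Lset_subset:
  assumes C: "closedin scott_topology C" and inf: "\<And>n. \<exists>m\<ge>n. H m s \<in> C"
  shows "Lset s \<subseteq> C"
proof -
  have "H m (n # s) \<in> C" for m n
    using inf [of n] C H_Cons_le_change_fst lower_setD unfolding closedin_scott_H_iff by blast
  then show ?thesis using C unfolding closedin_scott_H_iff Lset_def by blast
qed

text \<open>Among the elements of \<open>C\<close> above \<open>x\<close>, take one of shortest
  string; only its head can still rise. Unbounded heads would put the shorter \<open>H m s\<close>
  into \<open>C\<close>, so a largest head exists.\<close>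

lemma closed_ex_maximal_above:
  fixes x :: H
  assumes C: "closedin scott_topology C" and x: "x \<in> C"
  shows "\<exists>y\<in>C. x \<le> y \<and> (\<forall>z\<in>C. y \<le> z \<longrightarrow> z = y)"
proof -
  obtain y where y: "y \<in> C" "x \<le> y"
    and least: "\<And>z. z \<in> C \<Longrightarrow> x \<le> z \<Longrightarrow> string_length y \<le> string_length z"
    using ex_has_least_nat [of "\<lambda>z. z \<in> C \<and> x \<le> z" x string_length] x by blast
  obtain m v where ymv: "y = H m v" by (metis H.exhaust)
  show ?thesis
  proof (cases v)
    case Nil
    have "z = y" if "z \<in> C" "y \<le> z" for z
      using le_of_string_length_le [of y z] that by (auto simp: ymv Nil)
    then show ?thesis using y by blast
  next
    case (Cons n s)
    define N where "N = {n'. H m (n' # s) \<in> C}"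
    have n: "n \<in> N" using y by (simp add: N_def ymv Cons)
    have "finite N"
    proof (rule ccontr)
      assume inf: "infinite N"
      have "H m (k # s) \<in> C" for k
      proof -
        obtain n' where "n' \<ge> k" "n' \<in> N" using inf by (meson infinite_nat_iff_unbounded_le)
        then show ?thesis
          using C lower_set_headD unfolding N_def closedin_scott_H_iff by blast
      qed
      then have "H m s \<in> C" using C unfolding closedin_scott_H_iff by blast
      moreover have "x \<le> H m s"
        using y(2) H_Cons_le_tail order_trans unfolding ymv Cons by blast
      ultimately show False using least [of "H m s"] by (simp add: ymv Cons)
    qed
    define y' where "y' = H m (Max N # s)"
    have "Max N \<in> N" using n \<open>finite N\<close> Max_in by blast
    then have y': "y' \<in> C" by (simp add: N_def y'_def)
    have "y \<le> y'" using n \<open>finite N\<close> by (simp add: ymv Cons y'_def H_head_mono)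
    then have xy': "x \<le> y'" using y(2) by simp
    have "z = y'" if z: "z \<in> C" "y' \<le> z" for z
    proof -
      have "string_length y' \<le> string_length z"
        using least [of z] z xy' by (simp add: ymv Cons y'_def)
      moreover have "n' \<le> Max N" if "z = H m (n' # s)" for n'
        using that z(1) \<open>finite N\<close> by (simp add: N_def)
      ultimately show ?thesis
        using le_of_string_length_le [OF z(2)] by (fastforce simp: y'_def)
    qed
    then show ?thesis using y' xy' by blast
  qed
qed

section \<open>Irreducible closed sets\<close>

definition Lset_part :: "H set \<Rightarrow> H set" where
  "Lset_part C = \<Union> {Lset s | s. Lset s \<subseteq> C}"

lemma mem_Lset_part: "H m s \<in> Lset_part C \<longleftrightarrow> (\<forall>k. H k s \<in> C)"
  unfolding Lset_part_def Lset_def by blast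

lemma Lset_part_subset: "Lset_part C \<subseteq> C"
  unfolding Lset_part_def by blast

text \<open>Both closure conditions transfer from \<open>C\<close> for each number separately, the
  order by \<open>H_le_change_fst\<close>.\<close>

lemma closedin_Lset_part:
  assumes "closedin scott_topology C"
  shows "closedin scott_topology (Lset_part C)"
  unfolding closedin_scott_H_iff
proof (intro conjI allI impI)
  show "lower_set (Lset_part C)"
    unfolding lower_set_def
  proof (intro ballI allI impI)
    fix x y
    assume x: "x \<in> Lset_part C" and le: "y \<le> x"
    obtain m s m' s' where xy: "x = H m s" "y = H m' s'" by (cases x, cases y)
    have "H k s' \<le> H k s" for k using le unfolding xy by (rule H_le_change_fst)
    moreover have "H k s \<in> C" for k using x unfolding xy mem_Lset_part by blast
    ultimately show "y \<in> Lset_part C"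
      using assms lower_setD unfolding xy mem_Lset_part closedin_scott_H_iff by blast
  qed
next
  fix m s
  assume "\<forall>n. H m (n # s) \<in> Lset_part C"
  then show "H m s \<in> Lset_part C"
    using assms unfolding closedin_scott_H_iff mem_Lset_part by blast
qed

text \<open>If the limit \<open>H m s\<close> were missing, it would lie below \<open>x\<close>. For
  large \<open>n\<close>, some \<open>y\<close> in \<open>C\<close> not below \<open>x\<close>
  bounds \<open>H m (n # s)\<close>. In \<open>H_Cons_leE\<close>, the first case puts
  \<open>H m s\<close> into \<open>?B\<close> and the second puts \<open>y\<close> below
  \<open>x\<close>; the third gives \<open>H k s\<close> in \<open>C\<close> with
  \<open>k \<ge> n\<close>. Hence \<open>Lset s \<subseteq> C\<close>, a contradiction.\<close>

lemma closedin_Lset_part_Un_rest: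
  assumes C: "closedin scott_topology C"
  shows "closedin scott_topology (Lset_part C \<union> down_closure (C - down_closure {x}))"
    (is "closedin _ (?A \<union> ?B)")
  unfolding closedin_scott_H_iff
proof (intro conjI allI impI)
  have A: "closedin scott_topology ?A" using C by (rule closedin_Lset_part)
  show "lower_set (?A \<union> ?B)"
    using A lower_set_down_closure unfolding closedin_scott_H_iff lower_set_def by blast
  have sub: "?A \<union> ?B \<subseteq> C"
    using Lset_part_subset C down_closure_subset [of C "C - down_closure {x}"]
    unfolding closedin_scott_H_iff by blast
  fix m s
  assume all: "\<forall>n. H m (n # s) \<in> ?A \<union> ?B"
  then have msC: "H m s \<in> C" using sub C unfolding closedin_scott_H_iff by blast
  show "H m s \<in> ?A \<union> ?B"
  proof (rule ccontr)
    assume no: "H m s \<notin> ?A \<union> ?B"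
    then have le_x: "H m s \<le> x"
      using msC subset_down_closure [of "C - down_closure {x}"] by (auto simp: down_closure_def)
    obtain N where N: "H m (N # s) \<notin> ?A"
      using no A unfolding closedin_scott_H_iff by blast
    have "\<exists>k\<ge>n. H k s \<in> C" for n
    proof -
      \<comment> \<open>The lower set \<open>?A\<close> omits all heads from \<open>N\<close> on;
        \<open>n\<close> supplies the required bound.\<close>
      have "H m (max n N # s) \<notin> ?A"
        using N A lower_set_headD [of ?A m "max n N" s N] unfolding closedin_scott_H_iff by auto
      then obtain y where "y \<in> C" "\<not> y \<le> x" "H m (max n N # s) \<le> y"
        using all unfolding down_closure_def by blast
      then obtain m' s' where y: "H m' s' \<in> C" "\<not> H m' s' \<le> x" "H m (max n N # s) \<le> H m' s'"
        by (cases y) blast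
      from y(3) show ?thesis
      proof (cases rule: H_Cons_leE)
        case 1
        then show ?thesis using no y by (auto simp: down_closure_def)
      next
        case (2 n')
        then show ?thesis using y(2) le_x H_Cons_le_tail order_trans by blast
      next
        case 3
        then have "H m' s \<in> C"
          using y(1) C H_le_change_fst lower_setD unfolding closedin_scott_H_iff by blast
        then show ?thesis using 3 by auto
      qed
    qed
    then have "Lset s \<subseteq> C" using closed_Lset_subset [OF C] by blast
    then show False using no by (auto simp: mem_Lset_part Lset_def)
  qed
qed

text \<open>Since \<open>C\<close> consists of full sets \<open>Lset s'\<close>, the number of a
  bound \<open>H m' s'\<close> outside \<open>down_closure (Lset v)\<close> can be reset to
  \<open>m\<close>. The first and third cases of \<open>H_Cons_leE\<close> then place
  \<open>H m s\<close> below \<open>H m s'\<close>; the second would put \<open>H m s'\<close> below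
  \<open>H m v\<close>.\<close>

lemma closedin_down_closure_diff_Lset:
  assumes C: "closedin scott_topology C" and eq: "C \<subseteq> Lset_part C"
  shows "closedin scott_topology (down_closure (C - down_closure (Lset v)))"
    (is "closedin _ ?B")
  unfolding closedin_scott_H_iff
proof (intro conjI allI impI lower_set_down_closure)
  have sub: "?B \<subseteq> C"
    using C down_closure_subset [of C "C - down_closure (Lset v)"]
    unfolding closedin_scott_H_iff by blast
  fix m s
  assume all: "\<forall>n. H m (n # s) \<in> ?B"
  then have msC: "H m s \<in> C" using sub C unfolding closedin_scott_H_iff by blast
  show "H m s \<in> ?B"
  proof (cases "H m s \<le> H m v")
    case False
    then show ?thesis
      using msC subset_down_closure [of "C - down_closure (Lset v)"]
      by (auto simp: mem_down_closure_Lset)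
  next
    case True
    obtain y where "y \<in> C - down_closure (Lset v)" "H m (0 # s) \<le> y"
      using all unfolding down_closure_def [of "_ - _"] by blast
    then obtain m' s' where y: "H m' s' \<in> C - down_closure (Lset v)" "H m (0 # s) \<le> H m' s'"
      by (cases y) blast
    have nle: "\<not> H k s' \<le> H k v" for k
      using y(1) H_le_change_fst [of k s' k v m'] mem_down_closure_Lset [of m' s' v] by blast
    have "H m s' \<in> C - down_closure (Lset v)"
      using y(1) eq nle [of m] mem_Lset_part [of m' s' C] mem_down_closure_Lset [of m s' v] by blast
    moreover have "H m s \<le> H m s'"
      using y(2)
    proof (cases rule: H_Cons_leE)
      case 1
      then show ?thesis by (rule H_le_change_fst)
    next
      case (2 n')
      then show ?thesis using nle [of m] True H_Cons_le_tail order_trans by blast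
    qed
    ultimately show ?thesis unfolding down_closure_def by blast
  qed
qed

theorem theorem5p12:
  fixes C :: "H set"
  assumes "closedin scott_topology C"
    and "irreducible_in scott_topology C"
  shows "(\<exists>x. C = down_closure {x}) \<or> (\<exists>s. C = down_closure (Lset s))"
proof -
  note C = assms(1)
  have low: "lower_set C" using C unfolding closedin_scott_H_iff by blast
  \<comment> \<open>Irreducibility in usable form: a point of \<open>C\<close> outside
    \<open>B\<close> decides the cover in favour of \<open>A\<close>.\<close>
  have split: "C \<subseteq> A" if "closedin scott_topology A" "closedin scott_topology B"
    "C - A \<subseteq> B" "x \<in> C" "x \<notin> B" for A B x
  proof -
    have "C \<subseteq> A \<union> B" using that(3) by blast
    then have "C \<subseteq> A \<or> C \<subseteq> B"
      using assms(2) that(1,2) unfolding irreducible_in_def by simp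
    then show ?thesis using that(4,5) by (auto dest: subsetD)
  qed
  show ?thesis
  proof (cases "\<exists>x\<in>C. x \<notin> Lset_part C \<and> (\<forall>z\<in>C. x \<le> z \<longrightarrow> z = x)")
    case True
    then obtain x where x: "x \<in> C" "x \<notin> Lset_part C" and max: "\<And>z. z \<in> C \<Longrightarrow> x \<le> z \<Longrightarrow> z = x"
      by auto
    \<comment> \<open>By maximality, only \<open>x\<close> itself could witness membership in the
      second part, but it lies in \<open>down_closure {x}\<close>.\<close>
    have "x \<notin> Lset_part C \<union> down_closure (C - down_closure {x})"
      using x(2) max by (auto simp: down_closure_def)
    moreover have "C - down_closure {x} \<subseteq> Lset_part C \<union> down_closure (C - down_closure {x})"
      by (rule subset_trans [OF subset_down_closure Un_upper2])
    ultimately have "C \<subseteq> down_closure {x}"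
      using split [OF closedin_down_closure_singleton closedin_Lset_part_Un_rest [OF C]] x(1)
      by simp
    moreover have "down_closure {x} \<subseteq> C"
      using down_closure_subset [OF low] x(1) by simp
    ultimately show ?thesis by (metis subset_antisym)
  next
    case False
    have eq: "C \<subseteq> Lset_part C"
    proof
      fix x assume "x \<in> C"
      then obtain y where "y \<in> C" "x \<le> y" "\<forall>z\<in>C. y \<le> z \<longrightarrow> z = y"
        using closed_ex_maximal_above [OF C] by metis
      moreover from this have "y \<in> Lset_part C" using False by metis
      moreover have "lower_set (Lset_part C)"
        using closedin_Lset_part [OF C] by (simp add: closedin_scott_topology)
      ultimately show "x \<in> Lset_part C" by (metis lower_setD)
    qed
    obtain c where "c \<in> C" using assms(2) unfolding irreducible_in_def by auto
    then obtain x where x: "x \<in> C" and max: "\<And>z. z \<in> C \<Longrightarrow> x \<le> z \<Longrightarrow> z = x"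
      using closed_ex_maximal_above [OF C] by metis
    obtain m s where xms: "x = H m s" by (cases x)
    have "x \<notin> down_closure (C - down_closure (Lset s))"
    proof
      assume "x \<in> down_closure (C - down_closure (Lset s))"
      then have "x \<notin> down_closure (Lset s)"
        using max by (auto simp: down_closure_def)
      then show False by (simp add: xms mem_down_closure_Lset)
    qed
    then have "C \<subseteq> down_closure (Lset s)"
      using split [OF closedin_down_closure_Lset closedin_down_closure_diff_Lset [OF C eq]
          subset_down_closure] x by simp
    moreover have "Lset s \<subseteq> C"
      using x eq by (auto simp: xms Lset_def mem_Lset_part)
    then have "down_closure (Lset s) \<subseteq> C" by (rule down_closure_subset [OF low])
    ultimately show ?thesis by (metis subset_antisym)
  qed
qed

end
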